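(* Let $n$ be a positive integer, let $S\subseteq\mathbb{Z}_n$ with $S=-S$ and $0\notin S$, let $\Gamma=\mathrm{Cay}(\mathbb{Z}_n,S)$, and let $H\le\mathbb{Z}_n$ be a subgroup such that $\gcd\bigl(|H|,\,n/|H|\bigr)=1$. Then the pair $(\Gamma,H)$ satisfies the replacement property.
   Context: $\mathrm{Cay}(\mathbb{Z}_n,S)$ is the graph with vertex set $\mathbb{Z}_n$ in which $x,y$ are adjacent iff $y-x\in S$. For $g\in\mathbb{Z}_n$ let $g_r:\mathbb{Z}_n\to\mathbb{Z}_n$, $x\mapsto x+g$. Let $\mathcal{H}=\{H+g\mid g\in\mathbb{Z}_n\}$ be the partition of $\mathbb{Z}_n$ into cosets of $H$, and let $\mathrm{Aut}_{\mathcal H}(\Gamma)$ be the group of graph automorphisms $\sigma$ of $\Gamma$ with $\sigma[\mathfrak h]=\mathfrak h$ for every $\mathfrak h\in\mathcal H$. The pair $(\Gamma,H)$ satisfies the replacement property if there exists a function $f:\mathcal H\to\mathbb{Z}_n$ with $f(H)=0$ such that for every $\sigma\in\mathrm{Aut}_{\mathcal H}(\Gamma)$ there exists $\widetilde\sigma\in\mathrm{Aut}_{\mathcal H}(\Gamma)$ with $\widetilde\sigma|_{\mathfrak h}=f(\mathfrak h)_r\circ\sigma|_H\circ f(\mathfrak h)_r^{-1}$ for every $\mathfrak h\in\mathcal H$ (an equality of maps with domain $\mathfrak h$; so $f(\mathfrak h)\in\mathfrak h$ and $\widetilde\sigma(x)=\sigma(x-f(\mathfrak h))+f(\mathfrak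 h)$ for $x\in\mathfrak h$). *)

theory Defs
  imports
    "HOL-Algebra.Elementary_Groups"
    "HOL-Algebra.Bij"
    "Graph_Theory.Pair_Digraph"
begin

text \<open>
  The group \<open>\<int>\<^sub>n\<close> is \<^const>\<open>integer_mod_group\<close> from the library, whose operation
  (addition modulo \<open>n\<close>) is written multiplicatively.  In particular \<open>y - x\<close> is
  \<open>y \<otimes> inv x\<close>, and the coset \<open>H + g\<close> is \<open>H #> g\<close>.
\<close>

definition Cay :: "('a, 'b) monoid_scheme \<Rightarrow> 'a set \<Rightarrow> 'a pair_pre_digraph" where
  "Cay G S = \<lparr> pverts = carrier G,
     parcs = {(x, y). x \<in> carrier G \<and> y \<in> carrier G \<and> y \<otimes>\<^bsub>G\<^esub> inv\<^bsub>G\<^esub> x \<in> S} \<rparr>"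

definition graph_Aut :: "'a pair_pre_digraph \<Rightarrow> ('a \<Rightarrow> 'a) set" where
  "graph_Aut \<Gamma> = {\<sigma> \<in> Bij (pverts \<Gamma>).
     \<forall>x \<in> pverts \<Gamma>. \<forall>y \<in> pverts \<Gamma>. (\<sigma> x, \<sigma> y) \<in> parcs \<Gamma> \<longleftrightarrow> (x, y) \<in> parcs \<Gamma>}"

definition graph_Aut_fixing :: "'a pair_pre_digraph \<Rightarrow> 'a set set \<Rightarrow> ('a \<Rightarrow> 'a) set" where
  "graph_Aut_fixing \<Gamma> \<H> = {\<sigma> \<in> graph_Aut \<Gamma>. \<forall>\<hh> \<in> \<H>. \<sigma> ` \<hh> = \<hh>}"

text \<open>
  Write \<open>g\<^sub>r\<close> for the translation \<open>x \<mapsto> x + g\<close>.  The condition on \<open>\<sigma>'\<close> is the equation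
  \<open>\<sigma>'|\<^sub>\<hh> = f(\<hh>)\<^sub>r \<circ> \<sigma>|\<^sub>H \<circ> f(\<hh>)\<^sub>r\<^sup>-\<^sup>1\<close> of maps with domain \<open>\<hh>\<close>.  The right-hand side
  has domain \<open>H + f(\<hh>)\<close>, so the equality of domains says exactly that \<open>f(\<hh>) \<in> \<hh>\<close>.
\<close>

definition replacement_property ::
  "('a, 'b) monoid_scheme \<Rightarrow> 'a pair_pre_digraph \<Rightarrow> 'a set \<Rightarrow> bool" where
  "replacement_property G \<Gamma> H \<longleftrightarrow>
     (\<exists>f. f H = \<one>\<^bsub>G\<^esub> \<and> (\<forall>\<hh> \<in> rcosets\<^bsub>G\<^esub> H. f \<hh> \<in> \<hh>) \<and>
       (\<forall>\<sigma> \<in> graph_Aut_fixing \<Gamma> (rcosets\<^bsub>G\<^esub> H).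
          \<exists>\<sigma>' \<in> graph_Aut_fixing \<Gamma> (rcosets\<^bsub>G\<^esub> H).
            \<forall>\<hh> \<in> rcosets\<^bsub>G\<^esub> H. \<forall>x \<in> \<hh>.
              \<sigma>' x = \<sigma> (x \<otimes>\<^bsub>G\<^esub> inv\<^bsub>G\<^esub> (f \<hh>)) \<otimes>\<^bsub>G\<^esub> f \<hh>))"

end

theory Submission
  imports Defs "HOL-Algebra.Multiplicative_Group" "HOL-Number_Theory.Cong"
begin

text \<open>
  The Chinese remainder theorem provides \<open>e > 0\<close> with \<open>e \<equiv> 1\<close> modulo \<open>|H|\<close> and \<open>e \<equiv> 0\<close> modulo
  \<open>n / |H|\<close>, so that \<open>x \<mapsto> e x\<close> is the projection onto \<open>H\<close> along its complement \<open>K\<close>.  The property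
  holds with \<open>f\<close> choosing in each coset its element \<open>x - e x\<close> of \<open>K\<close>.

  Let \<open>\<sigma>\<close> be an automorphism fixing every coset of \<open>H\<close> and let \<open>T\<close> be the part of \<open>S\<close> in the coset
  \<open>H + c\<close> with \<open>c \<in> K\<close>.  Then \<open>\<sigma>\<close> is an automorphism of the Cayley digraph of \<open>T\<close>, hence it preserves
  the number of walks of length \<open>p\<close> from \<open>x\<close> to \<open>y\<close>, for each prime \<open>p\<close>.  Rotating the sequence of
  steps shows that this number is congruent modulo \<open>p\<close> to the number of \<open>t \<in> T\<close> with \<open>p t = y - x\<close>,
  which is at most \<open>1\<close> if \<open>p\<close> does not divide \<open>|H|\<close>.  So \<open>\<sigma>\<close> is an automorphism of the Cayley digraph
  of \<open>p T\<close>, and by iteration of that of \<open>e T = T - c\<close>.  Thus \<open>\<sigma>\<close> restricted to \<open>H\<close> preserves the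
  relation \<open>y - x \<in> T - c\<close> for every \<open>c\<close>, which is what is needed of \<open>\<sigma>'\<close>.
\<close>

section \<open>Fixed points of a map of prime period, counted modulo the prime\<close>

text \<open>By Bezout \<open>d * u = p * v + 1\<close> for some \<open>u\<close> and
  \<open>v\<close>. Both \<open>r ^^ (d * u)\<close> and \<open>r ^^ (p * v)\<close> fix
  \<open>x\<close>, and they differ by one application of \<open>r\<close>.\<close>

lemma funpow_id_on_eqI:
  assumes "coprime d p" and "(r ^^ d) x = x" and "(r ^^ p) x = x"
  shows "r x = x"
proof (cases "d = 0")
  case True
  with assms show ?thesis by simp
next
  case False
  then obtain u v where uv: "d * u = p * v + 1"
    using bezout_nat[of d p] assms(1) by (auto simp: coprime_iff_gcd_eq_1)
  have fix_mult: "(r ^^ (a * b)) x = x" if "(r ^^ a) x = x" for a b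
    using that by (induction b) (simp_all add: funpow_add)
  have "(r ^^ Suc (p * v)) x = x"
    using fix_mult[OF assms(2), of u] uv by simp
  then show ?thesis
    using fix_mult[OF assms(3), of v] by simp
qed

text \<open>The points moved by \<open>r\<close> form \<open>B\<close>, and their orbits, the
  classes of \<open>R\<close>, all have exactly \<open>p\<close> elements.\<close>

lemma card_cong_card_fixpoints:
  assumes "finite A" and p: "prime p" and r: "r \<in> A \<rightarrow> A"
    and rp: "\<And>x. x \<in> A \<Longrightarrow> (r ^^ p) x = x"
  shows "[card A = card {x \<in> A. r x = x}] (mod p)"
proof -
  define B where "B = {x \<in> A. r x \<noteq> x}"
  define R where "R = {(x, y). x \<in> B \<and> y \<in> B \<and> (\<exists>i<p. y = (r ^^ i) x)}"
  have p0: "0 < p" using p prime_gt_0_nat by blast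
  have A: "(r ^^ i) x \<in> A" if "x \<in> A" for i x
    using that r by (induction i) auto
  have cancel: "(r ^^ (p - i)) ((r ^^ i) x) = x" if "x \<in> A" "i \<le> p" for i x
    using that rp[of x] by (metis comp_apply funpow_add le_add_diff_inverse2)
  have mod_p: "(r ^^ i) x = (r ^^ (i mod p)) x" if "x \<in> A" for i x
    by (rule funpow_mod_eq[symmetric], rule rp, rule that)
  have B: "(r ^^ i) x \<in> B" if "x \<in> B" for i x
  proof -
    have x: "x \<in> A" "r x \<noteq> x" using that by (auto simp: B_def)
    \<comment> \<open>If \<open>r\<close> fixed an iterate of \<open>x\<close>, undoing the
      iteration would give \<open>r x = x\<close>. The exponent is reduced modulo \<open>p\<close>
      because \<open>cancel\<close> asks for \<open>i \<le> p\<close>.\<close>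
    have "r ((r ^^ i) x) \<noteq> (r ^^ i) x"
    proof
      assume "r ((r ^^ i) x) = (r ^^ i) x"
      then have "(r ^^ (i mod p)) (r x) = (r ^^ (i mod p)) x"
        using mod_p[of x i] mod_p[of "r x" i] x r by (metis funcset_mem funpow_swap1)
      then have "r x = x"
        using cancel[of x "i mod p"] cancel[of "r x" "i mod p"] x r p0
        by (metis funcset_mem less_imp_le mod_less_divisor)
      with x show False by simp
    qed
    with A x show ?thesis by (simp add: B_def)
  qed
  have equiv: "equiv B R"
  proof (rule equivI)
    show "R \<subseteq> B \<times> B" by (auto simp: R_def)
    show "refl_on B R"
      using p0 by (auto simp: R_def refl_on_def intro!: exI[of _ 0])
    show "sym R"
    proof (rule symI)
      fix x y assume "(x, y) \<in> R"
      then obtain i where i: "x \<in> B" "y \<in> B" "i < p" "y = (r ^^ i) x" by (auto simp: R_def)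
      then have "x = (r ^^ (p - i)) y" and "y \<in> A"
        using cancel[of x i] by (auto simp: B_def)
      then have "x = (r ^^ ((p - i) mod p)) y" using mod_p by metis
      moreover have "(p - i) mod p < p" using p0 by simp
      ultimately show "(y, x) \<in> R" using i(1,2) unfolding R_def by blast
    qed
    show "trans R"
    proof (rule transI)
      fix x y z assume "(x, y) \<in> R" "(y, z) \<in> R"
      then obtain i j where "x \<in> B" "z \<in> B" "z = (r ^^ j) ((r ^^ i) x)" by (auto simp: R_def)
      moreover from this have "z = (r ^^ ((j + i) mod p)) x"
        using mod_p[of x "j + i"] by (simp add: funpow_add B_def)
      moreover have "(j + i) mod p < p" using p0 by simp
      ultimately show "(x, z) \<in> R" unfolding R_def by blast
    qed
  qed
  have finB: "finite B" using assms(1) by (simp add: B_def)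
  have "p dvd card B"
  proof (rule equiv_imp_dvd_card[OF finB equiv])
    fix X assume "X \<in> B // R"
    then obtain x where x: "x \<in> B" and X: "X = R `` {x}" by (auto elim: quotientE)
    have "X = (\<lambda>i. (r ^^ i) x) ` {..<p}"
      using x B by (auto simp: X R_def)
    \<comment> \<open>Two equal iterates would make \<open>r ^^ (j - i)\<close> fix
      \<open>(r ^^ i) x\<close>. As \<open>0 < j - i < p\<close>, this exponent is coprime to
      \<open>p\<close>, so \<open>r\<close> itself would fix that point of \<open>B\<close>.\<close>
    moreover have "inj_on (\<lambda>i. (r ^^ i) x) {..<p}"
    proof (rule linorder_inj_onI)
      fix i j :: nat
      assume ij: "i < j" "i \<in> {..<p}" "j \<in> {..<p}"
      show "(r ^^ i) x \<noteq> (r ^^ j) x"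
      proof
        assume "(r ^^ i) x = (r ^^ j) x"
        then have "(r ^^ (j - i)) ((r ^^ i) x) = (r ^^ i) x"
          using ij by (metis comp_apply funpow_add le_add_diff_inverse2 less_imp_le)
        moreover have "coprime (j - i) p"
          using ij p by (metis coprime_commute diff_le_self dvd_imp_le lessThan_iff not_less
              order_le_less_trans prime_imp_coprime zero_less_diff)
        ultimately have "r ((r ^^ i) x) = (r ^^ i) x"
          using funpow_id_on_eqI[of "j - i" p r] rp[OF A] x by (auto simp: B_def)
        with B[OF x, of i] show False by (simp add: B_def)
      qed
    qed auto
    ultimately show "p dvd card X" by (simp add: card_image)
  qed
  moreover have "card A = card B + card {x \<in> A. r x = x}"
    unfolding B_def using assms(1) by (subst card_Un_disjoint[symmetric]) (auto intro: arg_cong[of _ _ card])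
  ultimately show ?thesis
    by (simp add: cong_def mod_add_left_eq[of "card B", symmetric] dvd_imp_mod_0)
qed

section \<open>Words over a connection set and their number modulo a prime\<close>

lemma (in group) graph_Aut_Cay_iff:
  "\<sigma> \<in> graph_Aut (Cay G T) \<longleftrightarrow> \<sigma> \<in> Bij (carrier G) \<and>
    (\<forall>x \<in> carrier G. \<forall>y \<in> carrier G. \<sigma> y \<otimes> inv (\<sigma> x) \<in> T \<longleftrightarrow> y \<otimes> inv x \<in> T)"
  by (auto simp: graph_Aut_def Cay_def dest: Bij_imp_funcset[THEN funcset_mem])

definition words :: "('a, 'b) monoid_scheme \<Rightarrow> 'a set \<Rightarrow> nat \<Rightarrow> 'a \<Rightarrow> 'a list set" where
  "words G T k d = {ws. length ws = k \<and> set ws \<subseteq> T \<and> foldr (\<otimes>\<^bsub>G\<^esub>) ws \<one>\<^bsub>G\<^esub> = d}"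

lemma finite_words: "finite T \<Longrightarrow> finite (words G T k d)"
  by (rule finite_subset[OF _ finite_lists_length_eq[of T k]]) (auto simp: words_def)

lemma (in monoid) foldr_mult_closed: "set ws \<subseteq> carrier G \<Longrightarrow> foldr (\<otimes>) ws \<one> \<in> carrier G"
  by (induction ws) auto

lemma (in monoid) foldr_mult_append:
  "set vs \<subseteq> carrier G \<Longrightarrow> set ws \<subseteq> carrier G \<Longrightarrow>
    foldr (\<otimes>) (vs @ ws) \<one> = foldr (\<otimes>) vs \<one> \<otimes> foldr (\<otimes>) ws \<one>"
  by (induction vs) (auto simp del: foldr_append simp: foldr_mult_closed m_assoc)

lemma (in comm_monoid) foldr_mult_rotate1:
  "set ws \<subseteq> carrier G \<Longrightarrow> foldr (\<otimes>) (rotate1 ws) \<one> = foldr (\<otimes>) ws \<one>"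
  by (cases ws) (auto simp del: foldr_append simp: foldr_mult_append foldr_mult_closed m_comm)

lemma (in comm_monoid) foldr_mult_replicate:
  "t \<in> carrier G \<Longrightarrow> foldr (\<otimes>) (replicate k t) \<one> = t [^] k"
  by (induction k) (simp_all add: m_comm)

text \<open>Rotation keeps the product by commutativity, and \<open>p\<close> rotations restore a
  word of length \<open>p\<close>. The words fixed by one rotation are constant, and the constant
  word in \<open>t\<close> has product \<open>t [^] p\<close>.\<close>

lemma (in comm_monoid) card_words_prime:
  fixes p :: nat
  assumes "finite T" and T: "T \<subseteq> carrier G" and p: "prime p"
  shows "[card (words G T p d) = card {t \<in> T. t [^] p = d}] (mod p)"
proof -
  have "[card (words G T p d) = card {ws \<in> words G T p d. rotate1 ws = ws}] (mod p)"
  proof (rule card_cong_card_fixpoints[OF finite_words[OF assms(1)] p])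
    show "rotate1 \<in> words G T p d \<rightarrow> words G T p d"
      using T by (auto simp: words_def foldr_mult_rotate1)
    show "(rotate1 ^^ p) ws = ws" if "ws \<in> words G T p d" for ws
      using that by (auto simp: words_def simp flip: rotate_def)
  qed
  also have "{ws \<in> words G T p d. rotate1 ws = ws} = replicate p ` {t \<in> T. t [^] p = d}"
  proof (intro equalityI subsetI)
    fix ws assume ws: "ws \<in> {ws \<in> words G T p d. rotate1 ws = ws}"
    then have "ws \<noteq> []" using p by (auto simp: words_def)
    with ws rotate1_fixpoint_card[of ws] obtain t where t: "set ws = {t}"
      by (auto simp: card_1_singleton_iff)
    then have "ws = replicate p t"
      using ws by (auto simp: words_def intro!: replicate_eqI)
    moreover have "t \<in> T" using t ws by (auto simp: words_def)
    ultimately show "ws \<in> replicate p ` {t \<in> T. t [^] p = d}"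
      using ws T by (auto simp: words_def foldr_mult_replicate subset_iff simp del: foldr_replicate)
  next
    fix ws assume "ws \<in> replicate p ` {t \<in> T. t [^] p = d}"
    then show "ws \<in> {ws \<in> words G T p d. rotate1 ws = ws}"
      using T by (auto simp: words_def foldr_mult_replicate subset_iff simp del: foldr_replicate)
  qed
  also have "card \<dots> = card {t \<in> T. t [^] p = d}"
  proof (rule card_image)
    show "inj_on (replicate p) {t \<in> T. t [^] p = d}"
      using prime_gt_0_nat[OF p] by (intro inj_onI) (simp add: replicate_eq_replicate)
  qed
  finally show ?thesis .
qed

text \<open>A first letter \<open>t\<close> leaves a word with product
  \<open>inv t \<otimes> d\<close>; this is the recursion on the first step of a walk.\<close>

lemma (in group) card_words_Suc:
  assumes "finite T" and T: "T \<subseteq> carrier G" and d: "d \<in> carrier G"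
  shows "card (words G T (Suc k) d) = (\<Sum>t\<in>T. card (words G T k (inv t \<otimes> d)))"
proof -
  have eq: "words G T (Suc k) d = (\<Union>t\<in>T. (#) t ` words G T k (inv t \<otimes> d))"
  proof (intro equalityI subsetI)
    fix ws assume "ws \<in> words G T (Suc k) d"
    then obtain t vs where "ws = t # vs" "t \<in> T" "set vs \<subseteq> T" "length vs = k"
        "t \<otimes> foldr (\<otimes>) vs \<one> = d"
      by (auto simp: words_def length_Suc_conv)
    moreover from this have "foldr (\<otimes>) vs \<one> = inv t \<otimes> d"
      using T d by (metis foldr_mult_closed inv_solve_left subset_trans subsetD)
    ultimately show "ws \<in> (\<Union>t\<in>T. (#) t ` words G T k (inv t \<otimes> d))"
      by (auto simp: words_def)
  next
    fix ws assume "ws \<in> (\<Union>t\<in>T. (#) t ` words G T k (inv t \<otimes> d))"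
    then show "ws \<in> words G T (Suc k) d"
      using T d by (auto simp: words_def subset_iff simp flip: m_assoc)
  qed
  have "card (words G T (Suc k) d) = (\<Sum>t\<in>T. card ((#) t ` words G T k (inv t \<otimes> d)))"
    unfolding eq using assms(1) by (intro card_UN_disjoint) (auto simp: finite_words)
  also have "\<dots> = (\<Sum>t\<in>T. card (words G T k (inv t \<otimes> d)))"
    by (intro sum.cong refl card_image) auto
  finally show ?thesis .
qed

section \<open>Automorphisms of Cayley digraphs and power maps on the connection set\<close>

context comm_group
begin

text \<open>The words of length \<open>k\<close> with product \<open>y - x\<close> correspond to the walks of length \<open>k\<close> from
  \<open>x\<close> to \<open>y\<close>, which an automorphism permutes.\<close>

lemma card_words_graph_Aut:
  assumes fin: "finite (carrier G)" and T: "T \<subseteq> carrier G"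
    and \<sigma>: "\<sigma> \<in> graph_Aut (Cay G T)"
    and "x \<in> carrier G" and "y \<in> carrier G"
  shows "card (words G T k (\<sigma> y \<otimes> inv (\<sigma> x))) = card (words G T k (y \<otimes> inv x))"
  using assms(4,5)
proof (induction k arbitrary: x)
  case 0
  \<comment> \<open>Only the empty word has length 0, so this case reduces to injectivity of
    \<open>\<sigma>\<close>.\<close>
  have "bij_betw \<sigma> (carrier G) (carrier G)"
    using \<sigma> by (simp add: graph_Aut_Cay_iff Bij_def)
  then have "\<sigma> y = \<sigma> x \<longleftrightarrow> y = x" and "\<sigma> x \<in> carrier G" "\<sigma> y \<in> carrier G"
    using 0 by (auto simp: bij_betw_def inj_on_eq_iff)
  moreover have *: "\<one> = b \<otimes> inv a \<longleftrightarrow> b = a" if "a \<in> carrier G" "b \<in> carrier G" for a b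
    using that inv_solve_right[of \<one> b a] by simp
  ultimately have "words G T 0 (\<sigma> y \<otimes> inv (\<sigma> x)) = words G T 0 (y \<otimes> inv x)"
    using 0 by (auto simp: words_def)
  then show ?case by simp
next
  case (Suc k)
  let ?N = "\<lambda>x. {z \<in> carrier G. z \<otimes> inv x \<in> T}"
  have finT: "finite T" using T fin finite_subset by blast
  have bij: "bij_betw \<sigma> (carrier G) (carrier G)"
    and ST: "\<And>x y. x \<in> carrier G \<Longrightarrow> y \<in> carrier G \<Longrightarrow> \<sigma> y \<otimes> inv (\<sigma> x) \<in> T \<longleftrightarrow> y \<otimes> inv x \<in> T"
    using \<sigma> by (simp_all add: graph_Aut_Cay_iff Bij_def)
  have S: "\<sigma> z \<in> carrier G" if "z \<in> carrier G" for z
    using bij that by (auto simp: bij_betw_def)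
  \<comment> \<open>Substituting \<open>z = t \<otimes> a\<close> turns the sum over first letters
    into a sum over the out-neighbours of \<open>a\<close>, which \<open>\<sigma>\<close> carries
    onto those of \<open>\<sigma> a\<close>.\<close>
  have step: "card (words G T (Suc k) (b \<otimes> inv a)) = (\<Sum>z\<in>?N a. card (words G T k (b \<otimes> inv z)))"
    if a: "a \<in> carrier G" and b: "b \<in> carrier G" for a b
  proof -
    have "card (words G T (Suc k) (b \<otimes> inv a)) = (\<Sum>t\<in>T. card (words G T k (inv t \<otimes> (b \<otimes> inv a))))"
      using a b T finT by (intro card_words_Suc) auto
    also have "\<dots> = (\<Sum>z\<in>?N a. card (words G T k (b \<otimes> inv z)))"
    proof (rule sum.reindex_bij_witness[of _ "\<lambda>z. z \<otimes> inv a" "\<lambda>t. t \<otimes> a"])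
      fix t assume "t \<in> T"
      then have t: "t \<in> carrier G" using T by auto
      show "t \<otimes> a \<otimes> inv a = t" using t a by (simp add: m_assoc)
      with \<open>t \<in> T\<close> show "t \<otimes> a \<in> ?N a" using t a by simp
      show "card (words G T k (b \<otimes> inv (t \<otimes> a))) = card (words G T k (inv t \<otimes> (b \<otimes> inv a)))"
        using t a b by (simp add: inv_mult m_lcomm)
    qed (use a T in \<open>auto simp: m_assoc\<close>)
    finally show ?thesis .
  qed
  have "card (words G T (Suc k) (\<sigma> y \<otimes> inv (\<sigma> x)))
      = (\<Sum>z\<in>?N (\<sigma> x). card (words G T k (\<sigma> y \<otimes> inv z)))"
    using Suc.prems S by (intro step) auto
  also have "\<dots> = (\<Sum>z\<in>?N x. card (words G T k (\<sigma> y \<otimes> inv (\<sigma> z))))"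
  proof (rule sum.reindex_bij_betw[symmetric])
    have "\<sigma> ` ?N x = ?N (\<sigma> x)"
    proof (intro equalityI subsetI)
      fix w assume w: "w \<in> ?N (\<sigma> x)"
      then obtain z where "z \<in> carrier G" "w = \<sigma> z" using bij by (auto simp: bij_betw_def)
      with w ST Suc.prems show "w \<in> \<sigma> ` ?N x" by auto
    qed (use ST S Suc.prems in auto)
    then show "bij_betw \<sigma> (?N x) (?N (\<sigma> x))"
      using bij by (auto simp: bij_betw_def intro: inj_on_subset)
  qed
  also have "\<dots> = (\<Sum>z\<in>?N x. card (words G T k (y \<otimes> inv z)))"
    using Suc by (intro sum.cong) auto
  also have "\<dots> = card (words G T (Suc k) (y \<otimes> inv x))"
    using Suc.prems by (intro step[symmetric]) auto
  finally show ?case .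
qed

text \<open>Injectivity leaves every \<open>d\<close> at most one \<open>p\<close>-th root in
  \<open>T\<close>, and 0 and 1 are distinct modulo \<open>p\<close>. Hence \<open>d\<close> is a
  \<open>p\<close>-th power from \<open>T\<close> iff \<open>p\<close> does not divide the number of
  words with product \<open>d\<close>, and \<open>\<sigma>\<close> preserves these numbers.\<close>

lemma graph_Aut_Cay_prime_power:
  fixes p :: nat
  assumes fin: "finite (carrier G)" and T: "T \<subseteq> carrier G"
    and \<sigma>: "\<sigma> \<in> graph_Aut (Cay G T)"
    and p: "prime p" and inj: "inj_on (\<lambda>t. t [^] p) T"
  shows "\<sigma> \<in> graph_Aut (Cay G ((\<lambda>t. t [^] p) ` T))"
proof -
  have finT: "finite T" using T fin finite_subset by blast
  have card: "card {t \<in> T. t [^] p = d} = (if d \<in> (\<lambda>t. t [^] p) ` T then 1 else 0)" for d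
  proof (cases "d \<in> (\<lambda>t. t [^] p) ` T")
    case True
    then obtain t where "t \<in> T" "d = t [^] p" by auto
    then have "{t \<in> T. t [^] p = d} = {t}" using inj by (auto dest: inj_onD)
    with True show ?thesis by simp
  next
    case False
    then have "{t \<in> T. t [^] p = d} = {}" by auto
    with False show ?thesis by (simp only: card.empty if_False)
  qed
  have "d \<in> (\<lambda>t. t [^] p) ` T \<longleftrightarrow> \<not> [card (words G T p d) = 0] (mod p)" for d
  proof -
    have "[card (words G T p d) = 0] (mod p) \<longleftrightarrow> [card {t \<in> T. t [^] p = d} = 0] (mod p)"
      using card_words_prime[OF finT T p] by (simp add: cong_def)
    then show ?thesis using prime_gt_1_nat[OF p] by (auto simp: card cong_0_iff)
  qed
  then show ?thesis
    using \<sigma> card_words_graph_Aut[OF fin T \<sigma>] by (simp add: graph_Aut_Cay_iff)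
qed

text \<open>Two elements of one coset with the same \<open>k\<close>-th power have a quotient in
  \<open>H\<close> whose order divides both \<open>k\<close> and \<open>card H\<close>.\<close>

lemma inj_on_pow_coset:
  fixes k :: nat
  assumes H: "subgroup H G" and finH: "finite H"
    and k: "coprime k (card H)" and a: "a \<in> carrier G" and T: "T \<subseteq> H #> a"
  shows "inj_on (\<lambda>t. t [^] k) T"
proof (rule inj_onI)
  fix s t assume "s \<in> T" "t \<in> T" and eq: "s [^] k = t [^] k"
  then have st: "s \<in> H #> a" "t \<in> H #> a" using T by auto
  then obtain h h' where h: "h \<in> H" "h' \<in> H" "s = h \<otimes> a" "t = h' \<otimes> a"
    by (auto simp: r_coset_def)
  then have hc: "h \<in> carrier G" "h' \<in> carrier G" using H subgroup.mem_carrier by metis+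
  interpret K: group "G\<lparr>carrier := H\<rparr>" using H subgroup_imp_group by blast
  have u: "h \<otimes> inv h' \<in> H" using h H by (simp add: subgroup.m_closed subgroup.m_inv_closed)
  then have uc: "h \<otimes> inv h' \<in> carrier G" using hc by simp
  have "(h \<otimes> inv h') [^] card H = \<one>"
    using K.pow_order_eq_1[of "h \<otimes> inv h'"] u
    by (simp add: order_def flip: nat_pow_consistent)
  moreover have "h [^] k = h' [^] k"
    using eq h hc a by (simp add: nat_pow_distrib)
  then have "(h \<otimes> inv h') [^] k = \<one>"
    using hc by (simp add: nat_pow_distrib nat_pow_inv)
  ultimately have "ord (h \<otimes> inv h') dvd gcd k (card H)"
    using uc by (simp add: pow_eq_id)
  then have "ord (h \<otimes> inv h') = 1" using k by simp
  then have "h \<otimes> inv h' = \<one>" using pow_ord_eq_1[OF uc] uc by simp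
  then have "h = \<one> \<otimes> h'" using hc by (intro inv_solve_right'[THEN iffD1]) auto
  then have "h = h'" using hc by simp
  then show "s = t" using h by simp
qed

text \<open>Induction over the prime factors of \<open>k\<close>: each is coprime to
  \<open>card H\<close>, so its power map is injective on \<open>T\<close>. The coset changes along
  the way, hence \<open>a\<close> and \<open>T\<close> are generalized.\<close>

lemma graph_Aut_Cay_power:
  fixes k :: nat
  assumes fin: "finite (carrier G)" and H: "subgroup H G"
    and "coprime k (card H)" and "k > 0"
    and "a \<in> carrier G" and "T \<subseteq> H #> a" and "\<sigma> \<in> graph_Aut (Cay G T)"
  shows "\<sigma> \<in> graph_Aut (Cay G ((\<lambda>t. t [^] k) ` T))"
  using assms(3-7)
proof (induction k arbitrary: a T rule: prime_divisors_induct)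
  case zero
  then show ?case by simp
next
  case (unit k)
  moreover have "T \<subseteq> carrier G"
    using unit H by (metis r_coset_subset_G subgroup.subset subset_trans)
  then have "(\<lambda>t. t [^] (1::nat)) ` T = T" by (force simp: image_iff)
  ultimately show ?case by simp
next
  case (factor p k)
  have T: "T \<subseteq> carrier G"
    using factor.prems H by (metis r_coset_subset_G subgroup.subset subset_trans)
  have finH: "finite H" using H fin by (metis finite_subset subgroup.subset)
  have "\<sigma> \<in> graph_Aut (Cay G ((\<lambda>t. t [^] p) ` T))"
  proof (rule graph_Aut_Cay_prime_power[OF fin T factor.prems(5) factor.hyps])
    show "inj_on (\<lambda>t. t [^] p) T"
      using factor.prems(1) by (intro inj_on_pow_coset[OF H finH _ factor.prems(3,4)]) simp
  qed
  \<comment> \<open>The remaining factors again need a set inside a single coset, now that of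
    \<open>a [^] p\<close>.\<close>
  moreover have "(\<lambda>t. t [^] p) ` T \<subseteq> H #> (a [^] p)"
  proof
    fix s assume "s \<in> (\<lambda>t. t [^] p) ` T"
    then obtain h where h: "h \<in> H" "s = (h \<otimes> a) [^] p"
      using factor.prems(4) by (auto simp: r_coset_def)
    moreover from h have "h \<in> carrier G" using H subgroup.mem_carrier by metis
    ultimately have "s = h [^] p \<otimes> a [^] p" using factor.prems by (simp add: nat_pow_distrib)
    moreover have "h [^] p \<in> H"
      using h(1) H by (induction p) (simp_all add: subgroup.one_closed subgroup.m_closed)
    ultimately show "s \<in> H #> (a [^] p)" by (auto simp: r_coset_def)
  qed
  ultimately have "\<sigma> \<in> graph_Aut (Cay G ((\<lambda>t. t [^] k) ` (\<lambda>t. t [^] p) ` T))"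
    using factor.prems(1-3) by (intro factor.IH[of "a [^] p"]) simp_all
  moreover have "(\<lambda>t. t [^] k) ` (\<lambda>t. t [^] p) ` T = (\<lambda>t. t [^] (p * k)) ` T"
    unfolding image_image using T by (intro image_cong) (auto simp: nat_pow_pow)
  ultimately show ?case by simp
qed

section \<open>Powers and cosets of a subgroup\<close>

text \<open>The order of \<open>H #> x\<close> in the quotient group divides the index of
  \<open>H\<close>.\<close>

lemma pow_index_mem_subgroup:
  assumes H: "subgroup H G" and "card (rcosets H) dvd k" and x: "x \<in> carrier G"
  shows "x [^] k \<in> H"
proof -
  interpret normal H G by (rule subgroup_imp_normal[OF H])
  interpret Q: group "G Mod H" by (rule factorgroup_is_group)
  have "H #> x \<in> carrier (G Mod H)" using x by (auto simp: carrier_FactGroup)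
  moreover have "order (G Mod H) dvd k" using assms(2) by (simp add: order_def FactGroup_def)
  ultimately have "(H #> x) [^]\<^bsub>G Mod H\<^esub> k = \<one>\<^bsub>G Mod H\<^esub>"
    using Q.pow_eq_id Q.ord_dvd_group_order dvd_trans by metis
  then have "H #> (x [^] k) = H" using x by (simp add: FactGroup_pow)
  then show ?thesis using x rcos_self[OF _ H] by fastforce
qed

lemma subgroup_pow_eq:
  assumes H: "subgroup H G" and "[k = 1] (mod card H)" and h: "h \<in> H"
  shows "h [^] k = h"
proof -
  interpret K: group "G\<lparr>carrier := H\<rparr>" using H subgroup_imp_group by blast
  have hc: "h \<in> carrier G" using H h subgroup.mem_carrier by metis
  have "h [^] card H = \<one>"
    using K.pow_order_eq_1[of h] h by (simp add: order_def flip: nat_pow_consistent)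
  then have "ord h dvd card H" using hc by (simp add: pow_eq_id)
  then have "[k = 1] (mod ord h)" using assms(2) cong_dvd_modulus_nat by metis
  then have "int (ord h) dvd int 1 - int k"
    by (metis cong_iff_dvd_diff cong_int_iff cong_sym)
  then have "h [^] int k = h [^] int 1" using int_pow_eq[OF hc] by metis
  then show ?thesis using hc by (simp only: int_pow_int) simp
qed

text \<open>Since \<open>\<sigma>\<close> keeps every coset of \<open>H\<close>, it does not change
  the coset in which \<open>y \<otimes> inv x\<close> lies. The intersection may fail to be
  symmetric, so this is a statement about digraphs.\<close>

lemma graph_Aut_Cay_Int_coset:
  assumes H: "subgroup H G" and a: "a \<in> carrier G"
    and \<sigma>: "\<sigma> \<in> graph_Aut_fixing (Cay G S) (rcosets H)"
  shows "\<sigma> \<in> graph_Aut (Cay G (S \<inter> (H #> a)))"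
proof -
  interpret H: subgroup H G by (rule H)
  have A: "\<sigma> \<in> graph_Aut (Cay G S)" and fix_coset: "\<And>X. X \<in> rcosets H \<Longrightarrow> \<sigma> ` X = X"
    using \<sigma> by (simp_all add: graph_Aut_fixing_def)
  have S: "\<sigma> x \<in> carrier G" if "x \<in> carrier G" for x
    using A that by (auto simp: graph_Aut_Cay_iff dest: Bij_imp_funcset)
  have coset: "H #> \<sigma> x = H #> x" if x: "x \<in> carrier G" for x
  proof -
    have "\<sigma> x \<in> H #> x"
      using fix_coset[of "H #> x"] x rcosetsI[OF H.subset x] rcos_self[OF x H] by auto
    then show ?thesis using repr_independence[OF _ x H] by simp
  qed
  have diff: "y \<otimes> inv x \<in> H #> a \<longleftrightarrow> H #> y = H #> (a \<otimes> x)"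
    if x: "x \<in> carrier G" and y: "y \<in> carrier G" for x y
  proof -
    have "y \<otimes> inv x \<in> H #> a \<longleftrightarrow> y \<otimes> inv x \<otimes> inv a \<in> H"
      using x y a by (intro H.rcos_module is_group) auto
    also have "y \<otimes> inv x \<otimes> inv a = y \<otimes> inv (a \<otimes> x)"
      using x y a by (simp add: inv_mult m_ac)
    also have "\<dots> \<in> H \<longleftrightarrow> y \<in> H #> (a \<otimes> x)"
      using x y a by (intro H.rcos_module[symmetric] is_group) auto
    also have "\<dots> \<longleftrightarrow> H #> y = H #> (a \<otimes> x)"
      using x y a repr_independence[OF _ _ H] rcos_self[OF y H] by (metis m_closed)
    finally show ?thesis .
  qed
  have mult: "H #> (a \<otimes> \<sigma> x) = H #> (a \<otimes> x)" if x: "x \<in> carrier G" for x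
    using coset[OF x] x S[OF x] a H.subset by (metis coset_mult_assoc m_comm)
  show ?thesis
    using A S by (auto simp: graph_Aut_Cay_iff diff coset mult)
qed

section \<open>Construction of the replacing automorphism in a finite abelian group\<close>

theorem replacement_property_Cay:
  assumes fin: "finite (carrier G)" and H: "subgroup H G"
    and cop: "coprime (card H) (card (rcosets H))"
  shows "replacement_property G (Cay G S) H"
proof -
  interpret H: subgroup H G by (rule H)
  obtain e0 where e0: "[e0 = 1] (mod card H)" "[e0 = 0] (mod card (rcosets H))"
    using binary_chinese_remainder_nat[OF cop] by blast
  \<comment> \<open>Adding the product keeps both congruences and makes the exponent positive;
    \<open>e0\<close> can be 0 when \<open>H\<close> is trivial.\<close>
  define e where "e = e0 + card H * card (rcosets H)"
  have "card (rcosets H) * card H > 0"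
    using lagrange[OF H] fin order_gt_0_iff_finite by simp
  then have card_pos: "card H > 0" "card (rcosets H) > 0" by simp_all
  have e_pos: "e > 0" using card_pos by (simp add: e_def)
  have e1: "[e = 1] (mod card H)" using e0(1) by (simp add: e_def cong_def)
  have e_dvd: "card (rcosets H) dvd e" using e0(2) by (simp add: e_def cong_0_iff)
  have e_cop: "coprime e (card H)" using e1 cong_imp_coprime cong_sym by (metis coprime_1_left)
  have pow_H: "h [^] e = h" if "h \<in> H" for h using subgroup_pow_eq[OF H e1 that] .
  have pow_mem: "x [^] e \<in> H" if "x \<in> carrier G" for x
    using pow_index_mem_subgroup[OF H e_dvd that] .
  \<comment> \<open>\<open>g\<close> is the projection onto the complement of \<open>H\<close>,
    which consists of the elements with \<open>e\<close>-th power \<open>\<one>\<close>. Thus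
    \<open>x\<close> is the product of \<open>x [^] e\<close> in \<open>H\<close> and
    \<open>g x\<close>, and \<open>g\<close> is constant on cosets of \<open>H\<close>.\<close>
  define g where "g x = x \<otimes> inv (x [^] e)" for x
  have g_closed: "g x \<in> carrier G" if "x \<in> carrier G" for x using that by (simp add: g_def)
  have g_pow: "g x [^] e = \<one>" if x: "x \<in> carrier G" for x
    using x pow_H[OF pow_mem[OF x]] by (simp add: g_def nat_pow_distrib nat_pow_inv)
  have g_H: "g (h \<otimes> x) = g x" if h: "h \<in> H" and x: "x \<in> carrier G" for h x
  proof -
    have hc: "h \<in> carrier G" using h by simp
    have "g (h \<otimes> x) = h \<otimes> (inv h \<otimes> (x \<otimes> inv (x [^] e)))"
      using hc x pow_H[OF h] by (simp add: g_def nat_pow_distrib inv_mult m_ac)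
    then show ?thesis using hc x by (simp add: g_def flip: m_assoc)
  qed
  have g_coset: "g y = g x" if "x \<in> carrier G" "y \<in> H #> x" for x y
    using that g_H by (auto simp: r_coset_def)
  have g_mem: "g x \<in> H #> x" if x: "x \<in> carrier G" for x
    using x H.m_inv_closed[OF pow_mem[OF x]] m_comm[OF x, of "inv (x [^] e)"]
    by (auto simp: r_coset_def g_def)
  have g_split: "x \<otimes> inv (g x) = x [^] e" if x: "x \<in> carrier G" for x
    using x by (simp add: g_def inv_mult m_assoc[symmetric])
  have g_mult: "x [^] e \<otimes> g x = x" if x: "x \<in> carrier G" for x
    using inv_solve_right'[of "x [^] e" x "g x"] g_split[OF x] g_closed[OF x] x by simp
  have rcosetD: "x \<in> carrier G" "X = H #> x" if X: "X \<in> rcosets H" and x: "x \<in> X" for X x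
  proof -
    from X obtain a where a: "a \<in> carrier G" "X = H #> a" by (auto simp: RCOSETS_def)
    then show "X = H #> x" using x repr_independence[of x H a] H by simp
    show "x \<in> carrier G" using H.rcosets_carrier[OF is_group X] x by blast
  qed
  \<comment> \<open>Any representative serves, since \<open>g\<close> is constant on each
    coset.\<close>
  define f where "f X = g (SOME x. x \<in> X)" for X
  have f: "f X = g x" if X: "X \<in> rcosets H" and x: "x \<in> X" for X x
  proof -
    have "x \<in> carrier G" "X = H #> x" using rcosetD[OF X x] .
    moreover have "(SOME x. x \<in> X) \<in> X" using x by (rule someI)
    ultimately show ?thesis using g_coset by (simp add: f_def)
  qed
  have "f H = g \<one>" using H.subgroup_in_rcosets[OF is_group] by (intro f) auto
  then have "f H = \<one>" by (simp add: g_def)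
  moreover have "f X \<in> X" if X: "X \<in> rcosets H" for X
  proof -
    from X obtain a where a: "a \<in> carrier G" "X = H #> a" by (auto simp: RCOSETS_def)
    then have "f X = g a" using X rcos_self[OF _ H] by (intro f) auto
    then show ?thesis using a g_mem by simp
  qed
  moreover have "\<exists>\<sigma>' \<in> graph_Aut_fixing (Cay G S) (rcosets H).
      \<forall>X \<in> rcosets H. \<forall>x \<in> X. \<sigma>' x = \<sigma> (x \<otimes> inv (f X)) \<otimes> f X"
    if \<sigma>: "\<sigma> \<in> graph_Aut_fixing (Cay G S) (rcosets H)" for \<sigma>
  proof -
    have bij: "bij_betw \<sigma> (carrier G) (carrier G)" and "\<sigma> ` H = H"
      using \<sigma> H.subgroup_in_rcosets[OF is_group]
      by (auto simp: graph_Aut_fixing_def graph_Aut_Cay_iff Bij_def)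
    then have \<sigma>_H: "\<sigma> h \<in> H" if "h \<in> H" for h using that by blast
    \<comment> \<open>\<open>\<sigma>'\<close> applies \<open>\<sigma>\<close> to the component in
      \<open>H\<close> and keeps the one in the complement. It is restricted to the carrier because
      \<open>Bij\<close> consists of extensional maps.\<close>
    define \<sigma>' where "\<sigma>' = (\<lambda>x \<in> carrier G. \<sigma> (x [^] e) \<otimes> g x)"
    have \<sigma>'_coset: "\<sigma>' x \<in> H #> x" if x: "x \<in> carrier G" for x
    proof -
      have "\<sigma>' x = \<sigma> (x [^] e) \<otimes> inv (x [^] e) \<otimes> x"
        using x \<sigma>_H[OF pow_mem[OF x]] by (simp add: \<sigma>'_def g_def m_ac)
      moreover have "\<sigma> (x [^] e) \<otimes> inv (x [^] e) \<in> H"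
        using x pow_mem \<sigma>_H by simp
      ultimately show ?thesis by (auto simp: r_coset_def)
    qed
    have \<sigma>'_closed: "\<sigma>' x \<in> carrier G" if "x \<in> carrier G" for x
      using \<sigma>'_coset[OF that] H.elemrcos_carrier[OF is_group that] by blast
    have inj: "inj_on \<sigma>' (carrier G)"
    proof (rule inj_onI)
      fix x y assume x: "x \<in> carrier G" and y: "y \<in> carrier G" and eq: "\<sigma>' x = \<sigma>' y"
      \<comment> \<open>\<open>\<sigma>' x\<close> lies in the coset of \<open>x\<close>, so the
        image determines \<open>g x\<close>; the rest is injectivity of
        \<open>\<sigma>\<close>.\<close>
      have gg: "g x = g y"
        using g_coset[OF x \<sigma>'_coset[OF x]] g_coset[OF y \<sigma>'_coset[OF y]] eq by simp
      have "\<sigma> (x [^] e) \<in> carrier G" "\<sigma> (y [^] e) \<in> carrier G"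
        using \<sigma>_H pow_mem x y by auto
      then have "\<sigma> (x [^] e) = \<sigma> (y [^] e)"
        using eq gg x y g_closed by (simp add: \<sigma>'_def)
      then have "x [^] e = y [^] e"
        using bij x y by (auto simp: bij_betw_def dest: inj_onD)
      then show "x = y" using gg g_mult x y by metis
    qed
    have "\<sigma>' ` carrier G = carrier G"
      using \<sigma>'_closed by (intro endo_inj_surj fin inj) auto
    moreover have "\<sigma>' \<in> extensional (carrier G)" by (simp add: \<sigma>'_def)
    ultimately have "\<sigma>' \<in> Bij (carrier G)" using inj by (simp add: Bij_def bij_betw_def)
    moreover have "\<sigma>' y \<otimes> inv (\<sigma>' x) \<in> S \<longleftrightarrow> y \<otimes> inv x \<in> S"
      if x: "x \<in> carrier G" and y: "y \<in> carrier G" for x y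
    proof -
      \<comment> \<open>\<open>c\<close> is the component in the complement both of
        \<open>y \<otimes> inv x\<close> and of
        \<open>\<sigma>' y \<otimes> inv (\<sigma>' x)\<close>, so only the components in
        \<open>H\<close> have to be compared.\<close>
      define c where "c = g y \<otimes> inv (g x)"
      have c: "c \<in> carrier G" using x y g_closed by (simp add: c_def)
      have c_pow: "c [^] e = \<one>"
        using x y g_closed g_pow by (simp add: c_def nat_pow_distrib nat_pow_inv)
      \<comment> \<open>As \<open>c\<close> lies in the complement of \<open>H\<close>, the \<open>e\<close>-th power sends \<open>h + c\<close> to \<open>h\<close>.\<close>
      have pow_T: "u \<in> (\<lambda>t. t [^] e) ` (S \<inter> (H #> c)) \<longleftrightarrow> u \<otimes> c \<in> S" if u: "u \<in> H" for u
      proof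
        assume "u \<in> (\<lambda>t. t [^] e) ` (S \<inter> (H #> c))"
        then obtain h where h: "h \<in> H" "h \<otimes> c \<in> S" "u = (h \<otimes> c) [^] e"
          by (auto simp: r_coset_def)
        then have "u = h"
          using c c_pow pow_H H.mem_carrier by (simp add: nat_pow_distrib)
        with h show "u \<otimes> c \<in> S" by simp
      next
        assume "u \<otimes> c \<in> S"
        moreover have "u = (u \<otimes> c) [^] e"
          using c c_pow pow_H[OF u] H.mem_carrier[OF u] by (simp add: nat_pow_distrib)
        ultimately show "u \<in> (\<lambda>t. t [^] e) ` (S \<inter> (H #> c))"
          using u by (auto simp: r_coset_def)
      qed
      have \<sigma>_e: "\<sigma> \<in> graph_Aut (Cay G ((\<lambda>t. t [^] e) ` (S \<inter> (H #> c))))"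
        by (rule graph_Aut_Cay_power[OF fin H e_cop e_pos c _ graph_Aut_Cay_Int_coset[OF H c \<sigma>]]) simp
      define u v where "u = x [^] e" and "v = y [^] e"
      have uv: "u \<in> H" "v \<in> H" "\<sigma> u \<in> H" "\<sigma> v \<in> H"
        using x y pow_mem \<sigma>_H by (auto simp: u_def v_def)
      have diff: "(b \<otimes> g y) \<otimes> inv (a \<otimes> g x) = b \<otimes> inv a \<otimes> c" if "a \<in> H" "b \<in> H" for a b
        using that x y g_closed H.mem_carrier by (simp add: c_def inv_mult m_ac)
      have "y \<otimes> inv x = (v \<otimes> g y) \<otimes> inv (u \<otimes> g x)"
        using x y g_mult by (simp add: u_def v_def)
      then have "y \<otimes> inv x = v \<otimes> inv u \<otimes> c" using diff uv by simp
      moreover have "\<sigma>' y \<otimes> inv (\<sigma>' x) = \<sigma> v \<otimes> inv (\<sigma> u) \<otimes> c"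
        using diff uv x y by (simp add: \<sigma>'_def u_def v_def)
      moreover have "\<sigma> v \<otimes> inv (\<sigma> u) \<in> (\<lambda>t. t [^] e) ` (S \<inter> (H #> c))
          \<longleftrightarrow> v \<otimes> inv u \<in> (\<lambda>t. t [^] e) ` (S \<inter> (H #> c))"
        using \<sigma>_e uv(1,2)[THEN H.mem_carrier] unfolding graph_Aut_Cay_iff by blast
      ultimately show ?thesis
        using uv pow_T[of "v \<otimes> inv u"] pow_T[of "\<sigma> v \<otimes> inv (\<sigma> u)"] by simp
    qed
    moreover have "\<sigma>' ` X = X" if X: "X \<in> rcosets H" for X
    proof (rule endo_inj_surj)
      have XG: "X \<subseteq> carrier G" using H.rcosets_carrier[OF is_group X] .
      then show "finite X" using fin finite_subset by blast
      show "inj_on \<sigma>' X" using inj XG inj_on_subset by blast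
      show "\<sigma>' ` X \<subseteq> X"
      proof
        fix z assume "z \<in> \<sigma>' ` X"
        then obtain x where x: "x \<in> X" "z = \<sigma>' x" by auto
        then have "X = H #> x" using rcosetD[OF X] by simp
        then show "z \<in> X" using x XG \<sigma>'_coset by blast
      qed
    qed
    ultimately have "\<sigma>' \<in> graph_Aut_fixing (Cay G S) (rcosets H)"
      by (simp add: graph_Aut_fixing_def graph_Aut_Cay_iff)
    \<comment> \<open>Here \<open>f X = g x\<close>, which turns
      \<open>x \<otimes> inv (f X)\<close> into \<open>x [^] e\<close>.\<close>
    moreover have "\<sigma>' x = \<sigma> (x \<otimes> inv (f X)) \<otimes> f X" if X: "X \<in> rcosets H" and x: "x \<in> X" for X x
    proof -
      have "x \<in> carrier G" using rcosetD(1)[OF X x] .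
      then show ?thesis using f[OF X x] g_split by (simp add: \<sigma>'_def)
    qed
    ultimately show ?thesis by blast
  qed
  ultimately show ?thesis unfolding replacement_property_def by blast
qed

end

section \<open>The case of the integers modulo n\<close>

theorem theorem1p1:
  fixes n :: nat and S H :: "int set"
  assumes "n > 0"
    and "S \<subseteq> carrier (integer_mod_group n)"
    and "set_inv\<^bsub>integer_mod_group n\<^esub> S = S"
    and "\<one>\<^bsub>integer_mod_group n\<^esub> \<notin> S"
    and "subgroup H (integer_mod_group n)"
    and "gcd (card H) (n div card H) = 1"
  shows "replacement_property (integer_mod_group n) (Cay (integer_mod_group n) S) H"
proof -
  interpret comm_group "integer_mod_group n" by simp
  have fin: "finite (carrier (integer_mod_group n))"
    using assms(1) by (simp add: carrier_integer_mod_group)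
  \<comment> \<open>Lagrange identifies \<open>n div card H\<close> with the index of
    \<open>H\<close>, which turns the gcd condition into coprimality of order and index.\<close>
  have "card (rcosets\<^bsub>integer_mod_group n\<^esub> H) * card H = n"
    using lagrange[OF assms(5)] assms(1) by (simp add: order_def carrier_integer_mod_group)
  moreover from this have "card H > 0" using assms(1) by (auto intro: Nat.gr0I)
  ultimately have "n div card H = card (rcosets\<^bsub>integer_mod_group n\<^esub> H)"
    by (metis nonzero_mult_div_cancel_right less_not_refl)
  then show ?thesis
    using replacement_property_Cay[OF fin assms(5)] assms(6)
    by (simp add: coprime_iff_gcd_eq_1)
qed

end
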